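(* Let $\delta_1, \delta_2, \ldots$ be an infinite sequence of nonnegative real numbers and let $r_1 \leq r_2 \leq \ldots$ be an infinite nondecreasing sequence of positive integers. Consider the unbounded test that stops and declares the null hypothesis false at the first decision point $t \in \{1, 2, \ldots\}$ at which at least $r_t$ of the decision points $k \in \{1, \ldots, t\}$ have $p_k \leq \delta_k$, where $p_k$ is the $p$-value at decision point $k$ based on the data from the start of the test until decision point $k$; if no such $t$ exists, the test runs forever without declaring the null hypothesis false. Then the Type I error probability of this test is at most $$\sum_{t=1}^{\infty} \frac{\delta_t}{r_t}.$$
   Context: A test has decision points (interim analyses) $t = 1, 2, 3, \ldots$. At each decision point $k$ a $p$-value $p_k$ (a random variable) for the null hypothesis is computed. The only property of $p$-values used is validity at each decision point: when the null hypothesis holds, $\Pr\{p_k \le x\} \le x$ for every $x \ge 0$. No assumption is made about the joint distribution of $p_1, p_2, \ldots$ (arbitrary dependence is allowed). A Type I error is the event that the test rejects (declares false) the null hypothesis although the null hypothesis holds; the Type I error probability is the probability of this event, i.e. the probability that the test rejects when the null hypothesis holds. The bounding series may equal $+\infty$, in which case the bound is vacuous. *)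

theory Defs
  imports "HOL-Probability.Probability"
begin

(* The measure M is a distribution of the data under which the null hypothesis holds. *)
definition valid_p_value :: "'a measure \<Rightarrow> ('a \<Rightarrow> real) \<Rightarrow> bool" where
  "valid_p_value M P \<longleftrightarrow>
     P \<in> borel_measurable M \<and> (\<forall>x\<ge>0. measure M {\<omega> \<in> space M. P \<omega> \<le> x} \<le> x)"

(* Decision points are 1, 2, 3, ...; index 0 of p, d and r is never used. *)
definition crosses ::
  "(nat \<Rightarrow> 'a \<Rightarrow> real) \<Rightarrow> (nat \<Rightarrow> real) \<Rightarrow> (nat \<Rightarrow> nat) \<Rightarrow> 'a \<Rightarrow> nat \<Rightarrow> bool" where
  "crosses p d r \<omega> t \<longleftrightarrow> 1 \<le> t \<and> r t \<le> card {k \<in> {1..t}. p k \<omega> \<le> d k}"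

(* The value \<infinity> means that the test runs forever. *)
definition stopping_point ::
  "(nat \<Rightarrow> 'a \<Rightarrow> real) \<Rightarrow> (nat \<Rightarrow> real) \<Rightarrow> (nat \<Rightarrow> nat) \<Rightarrow> 'a \<Rightarrow> enat" where
  "stopping_point p d r \<omega> =
     (if \<exists>t. crosses p d r \<omega> t then enat (LEAST t. crosses p d r \<omega> t) else \<infinity>)"

(* The test declares the null hypothesis false exactly when it stops. *)
definition rejects ::
  "(nat \<Rightarrow> 'a \<Rightarrow> real) \<Rightarrow> (nat \<Rightarrow> real) \<Rightarrow> (nat \<Rightarrow> nat) \<Rightarrow> 'a \<Rightarrow> bool" where
  "rejects p d r \<omega> \<longleftrightarrow> stopping_point p d r \<omega> < \<infinity>"

definition type_I_error_prob ::
  "'a measure \<Rightarrow> (nat \<Rightarrow> 'a \<Rightarrow> real) \<Rightarrow> (nat \<Rightarrow> real) \<Rightarrow> (nat \<Rightarrow> nat) \<Rightarrow> real" where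
  "type_I_error_prob M p d r = measure M {\<omega> \<in> space M. rejects p d r \<omega>}"

(* Since measure is 0 on non-measurable sets, type_I_error_prob is only meaningful
   because the rejection event is measurable. *)
lemma rejects_measurable:
  assumes "\<And>k. 1 \<le> k \<Longrightarrow> p k \<in> borel_measurable M"
  shows "{\<omega> \<in> space M. rejects p d r \<omega>} \<in> sets M"
proof -
  have cross: "{\<omega> \<in> space M. crosses p d r \<omega> t} \<in> sets M" for t
  proof -
    have "{\<omega> \<in> space M. crosses p d r \<omega> t} =
      (\<Union>A \<in> {A \<in> Pow {1..t}. 1 \<le> t \<and> r t \<le> card A}.
         {\<omega> \<in> space M. \<forall>k\<in>{1..t}. (p k \<omega> \<le> d k) = (k \<in> A)})"
    proof (intro set_eqI iffI)
      fix \<omega> assume "\<omega> \<in> {\<omega> \<in> space M. crosses p d r \<omega> t}"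
      then show "\<omega> \<in> (\<Union>A \<in> {A \<in> Pow {1..t}. 1 \<le> t \<and> r t \<le> card A}.
         {\<omega> \<in> space M. \<forall>k\<in>{1..t}. (p k \<omega> \<le> d k) = (k \<in> A)})"
        by (intro UN_I[of "{k \<in> {1..t}. p k \<omega> \<le> d k}"]) (auto simp: crosses_def)
    next
      fix \<omega> assume "\<omega> \<in> (\<Union>A \<in> {A \<in> Pow {1..t}. 1 \<le> t \<and> r t \<le> card A}.
         {\<omega> \<in> space M. \<forall>k\<in>{1..t}. (p k \<omega> \<le> d k) = (k \<in> A)})"
      then obtain A where A: "A \<subseteq> {1..t}" "1 \<le> t" "r t \<le> card A" "\<omega> \<in> space M"
        "\<forall>k\<in>{1..t}. (p k \<omega> \<le> d k) = (k \<in> A)" by auto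
      then have "{k \<in> {1..t}. p k \<omega> \<le> d k} = A" by blast
      with A show "\<omega> \<in> {\<omega> \<in> space M. crosses p d r \<omega> t}" by (simp add: crosses_def)
    qed
    also have "\<dots> \<in> sets M"
    proof (intro sets.finite_UN sets.sets_Collect_finite_All)
      fix A k assume "k \<in> {1..t}"
      then have [measurable]: "p k \<in> borel_measurable M" using assms by simp
      show "{\<omega> \<in> space M. (p k \<omega> \<le> d k) = (k \<in> A)} \<in> sets M" by measurable
    qed auto
    finally show ?thesis .
  qed
  have "{\<omega> \<in> space M. rejects p d r \<omega>} = (\<Union>t. {\<omega> \<in> space M. crosses p d r \<omega> t})"
    by (auto simp: rejects_def stopping_point_def)
  also have "\<dots> \<in> sets M" using cross by blast
  finally show ?thesis .
qed

end

theory Submission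
  imports Defs
begin

text \<open>If the test rejects at time \<open>t\<close>, at least \<open>r t\<close> indices \<open>k \<le> t\<close> satisfy \<open>p k \<le> d k\<close>, and each of
  them contributes \<open>1 / r k \<ge> 1 / r t\<close> to \<open>W = (\<Sum>k. (1 / r k) * indicator {p k \<le> d k})\<close>, so \<open>W \<ge> 1\<close>. Integrating
  the resulting bound of the indicator of the rejection event by \<open>W\<close> gives the claim; linearity of the
  integral is insensitive to the dependence between the p-values.\<close>

lemma crosses_weight_ge_1:
  assumes cross: "crosses p d r \<omega> t"
    and pos: "\<And>t. 1 \<le> t \<Longrightarrow> 0 < r t"
    and mono: "mono_on {1..} r"
  shows "1 \<le> (\<Sum>k = 1..t. of_bool (p k \<omega> \<le> d k) / real (r k))"
proof -
  let ?A = "{k \<in> {1..t}. p k \<omega> \<le> d k}"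
  have t: "1 \<le> t" "r t \<le> card ?A" using cross by (auto simp: crosses_def)
  have "1 \<le> real (card ?A) / real (r t)"
    using t pos[OF t(1)] by simp
  also have "\<dots> = (\<Sum>k\<in>?A. 1 / real (r t))" by simp
  also have "\<dots> \<le> (\<Sum>k\<in>?A. 1 / real (r k))"
  proof (rule sum_mono)
    fix k assume "k \<in> ?A"
    \<comment> \<open>Positivity of \<open>r k\<close> matters beyond monotonicity:
      \<open>1 / 0 = 0\<close> in HOL, so the comparison of reciprocals would fail at
      \<open>r k = 0\<close>.\<close>
    then have "0 < r k" "r k \<le> r t"
      using pos monotone_onD[OF mono, of k t] by auto
    then show "1 / real (r t) \<le> 1 / real (r k)"
      by (simp add: frac_le)
  qed
  also have "\<dots> = (\<Sum>k = 1..t. of_bool (p k \<omega> \<le> d k) / real (r k))"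
    by (intro sum.mono_neutral_cong_left) auto
  finally show ?thesis .
qed

text \<open>The crossing point varies with \<open>\<omega>\<close>; extending the finite sum by
  nonnegative terms gives one bound for all rejecting outcomes. Values in \<open>ennreal\<close>
  allow the series to diverge.\<close>

lemma rejects_weight_ge_1:
  assumes "rejects p d r \<omega>"
    and "\<And>t. 1 \<le> t \<Longrightarrow> 0 < r t"
    and "mono_on {1..} r"
  shows "1 \<le> (\<Sum>k. ennreal (of_bool (p (Suc k) \<omega> \<le> d (Suc k)) / real (r (Suc k))))"
proof -
  let ?w = "\<lambda>k. of_bool (p k \<omega> \<le> d k) / real (r k)"
  obtain t where "crosses p d r \<omega> t"
    using assms(1) by (auto simp: rejects_def stopping_point_def split: if_splits)
  then have "1 \<le> (\<Sum>k = 1..t. ?w k)"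
    using assms by (intro crosses_weight_ge_1)
  \<comment> \<open>Decision points start at 1, but the series is indexed from 0.\<close>
  also have "\<dots> = (\<Sum>k<t. ?w (Suc k))"
    by (rule sum.reindex_bij_witness[of _ Suc "\<lambda>k. k - 1"]) auto
  finally have "ennreal 1 \<le> ennreal (\<Sum>k<t. ?w (Suc k))"
    by (rule ennreal_leI)
  also have "\<dots> = (\<Sum>k<t. ennreal (?w (Suc k)))"
    by (rule sum_ennreal[symmetric]) simp
  also have "\<dots> \<le> (\<Sum>k. ennreal (?w (Suc k)))"
    by (rule sum_le_suminf) auto
  finally show ?thesis by simp
qed

theorem theorem2:
  fixes M :: "'a measure"
    and p :: "nat \<Rightarrow> 'a \<Rightarrow> real"
    and d :: "nat \<Rightarrow> real"
    and r :: "nat \<Rightarrow> nat"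
  assumes "prob_space M"
    and "\<And>k. 1 \<le> k \<Longrightarrow> valid_p_value M (p k)"
    and "\<And>t. 1 \<le> t \<Longrightarrow> 0 \<le> d t"
    and "\<And>t. 1 \<le> t \<Longrightarrow> 0 < r t"
    and "mono_on {1..} r"
  shows "ennreal (type_I_error_prob M p d r) \<le> (\<Sum>t. ennreal (d (Suc t) / real (r (Suc t))))"
proof -
  interpret prob_space M by fact
  let ?R = "{\<omega> \<in> space M. rejects p d r \<omega>}"
  let ?w = "\<lambda>k \<omega>. ennreal (of_bool (p (Suc k) \<omega> \<le> d (Suc k)) / real (r (Suc k)))"
  have [measurable]: "p (Suc k) \<in> borel_measurable M" for k
    using assms(2)[of "Suc k"] by (simp add: valid_p_value_def)
  have R: "?R \<in> sets M"
    using assms(2) by (intro rejects_measurable) (simp add: valid_p_value_def)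
  have w_integral: "(\<integral>\<^sup>+\<omega>. ?w k \<omega> \<partial>M) \<le> ennreal (d (Suc k) / real (r (Suc k)))" for k
  proof -
    let ?E = "{\<omega> \<in> space M. p (Suc k) \<omega> \<le> d (Suc k)}"
    have "(\<integral>\<^sup>+\<omega>. ?w k \<omega> \<partial>M) = (\<integral>\<^sup>+\<omega>. ennreal (1 / real (r (Suc k))) * indicator ?E \<omega> \<partial>M)"
      by (intro nn_integral_cong) (auto simp: indicator_def)
    also have "\<dots> = ennreal (1 / real (r (Suc k))) * emeasure M ?E"
      by (rule nn_integral_cmult_indicator) measurable
    also have "\<dots> = ennreal (prob ?E / real (r (Suc k)))"
      by (simp add: emeasure_eq_measure ennreal_mult[symmetric])
    \<comment> \<open>Validity is applied at \<open>x = d (Suc k)\<close>, which is admissible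
      because this threshold is nonnegative.\<close>
    also have "\<dots> \<le> ennreal (d (Suc k) / real (r (Suc k)))"
      using assms(2)[of "Suc k"] assms(3)[of "Suc k"]
      by (intro ennreal_leI divide_right_mono) (auto simp: valid_p_value_def)
    finally show ?thesis .
  qed
  \<comment> \<open>Measurability of \<open>?R\<close> is essential here: \<open>measure\<close>
    defaults to 0 on non-measurable sets.\<close>
  have "ennreal (type_I_error_prob M p d r) = (\<integral>\<^sup>+\<omega>. indicator ?R \<omega> \<partial>M)"
    using R by (simp add: type_I_error_prob_def emeasure_eq_measure)
  also have "\<dots> \<le> (\<integral>\<^sup>+\<omega>. (\<Sum>k. ?w k \<omega>) \<partial>M)"
  proof (rule nn_integral_mono)
    fix \<omega> assume "\<omega> \<in> space M"
    show "indicator ?R \<omega> \<le> (\<Sum>k. ?w k \<omega>)"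
    proof (cases "rejects p d r \<omega>")
      case True
      have "indicator ?R \<omega> \<le> (1 :: ennreal)"
        by (simp split: split_indicator)
      also have "\<dots> \<le> (\<Sum>k. ?w k \<omega>)"
        using True assms(4,5) by (rule rejects_weight_ge_1)
      finally show ?thesis .
    qed simp
  qed
  \<comment> \<open>Monotone convergence extends linearity to the countable sum of nonnegative
    terms, even if the total is infinite.\<close>
  also have "\<dots> = (\<Sum>k. \<integral>\<^sup>+\<omega>. ?w k \<omega> \<partial>M)"
    by (rule nn_integral_suminf) measurable
  also have "\<dots> \<le> (\<Sum>k. ennreal (d (Suc k) / real (r (Suc k))))"
    using w_integral by (intro suminf_le) auto
  finally show ?thesis .
qed

end
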